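(* The algebra $\tilde{\mathcal A}_q^{\{\delta\}}$ is generated by $\mathcal W_0,\mathcal W_1$.
   Context: Conventions. $\mathbb K$ is a field, $q\in\mathbb K$ is nonzero and not a root of unity, $\rho\in\mathbb K$ is nonzero, $\mathbb Z_+$ is the set of nonnegative integers, $[X,Y]=XY-YX$, $[X,Y]_q=qXY-q^{-1}YX$. All summation indices $i,j,l,m$ range in $\mathbb Z_+$; empty sums are zero. The algebra $\mathcal A_q$. It is the unital associative $\mathbb K$-algebra with generators $\{\mathcal W_{-k},\mathcal W_{k+1},\mathcal G_{k+1},\tilde{\mathcal G}_{k+1}\mid k\in\mathbb Z_+\}$ and the following relations. Put $U=(qu^2+q^{-1}u^{-2})/(q+q^{-1})$, $V=(qv^2+q^{-1}v^{-2})/(q+q^{-1})$ with $u,v$ indeterminates, and $$\mathcal W_+(u)=\sum_{k\in\mathbb Z_+}\mathcal W_{-k}U^{-k-1},\quad \mathcal W_-(u)=\sum_{k\in\mathbb Z_+}\mathcal W_{k+1}U^{-k-1},\quad \mathcal G_+(u)=\sum_{k\in\mathbb Z_+}\mathcal G_{k+1}U^{-k-1},\quad \mathcal G_-(u)=\sum_{k\in\mathbb Z_+}\tilde{\mathcal G}_{k+1}U^{-k-1}$$ (and the same with $v,V$). The relations (identities of formal series; each holds for the upper and for the lower choice of signs, and fractions with denominator $U-V$ are understood after multiplying by $U-V$) are: (1) $[\mathcal W_\pm(u),\mathcal W_\pm(v)]=0$; (2) $[\mathcal W_+(u),\mathcal W_-(v)]+[\mathcal W_-(u),\mathcal W_+(v)]=0$;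 (3) $(U-V)[\mathcal W_\pm(u),\mathcal W_\mp(v)]=\frac{q-q^{-1}}{\rho(q+q^{-1})}\big(\mathcal G_\pm(u)\mathcal G_\mp(v)-\mathcal G_\pm(v)\mathcal G_\mp(u)\big)+\frac{1}{q+q^{-1}}\big(\mathcal G_\pm(u)-\mathcal G_\mp(u)+\mathcal G_\mp(v)-\mathcal G_\pm(v)\big)$; (4) $\mathcal W_\pm(u)\mathcal W_\pm(v)-\mathcal W_\mp(u)\mathcal W_\mp(v)+\frac{1}{\rho(q^2-q^{-2})}[\mathcal G_\pm(u),\mathcal G_\mp(v)]+\frac{1-UV}{U-V}\big(\mathcal W_\pm(u)\mathcal W_\mp(v)-\mathcal W_\pm(v)\mathcal W_\mp(u)\big)=0$; (5) $U[\mathcal G_\mp(v),\mathcal W_\pm(u)]_q-V[\mathcal G_\mp(u),\mathcal W_\pm(v)]_q-(q-q^{-1})\big(\mathcal W_\mp(u)\mathcal G_\mp(v)-\mathcal W_\mp(v)\mathcal G_\mp(u)\big)+\rho\big(U\mathcal W_\pm(u)-V\mathcal W_\pm(v)-\mathcal W_\mp(u)+\mathcal W_\mp(v)\big)=0$; (6) $U[\mathcal W_\mp(u),\mathcal G_\mp(v)]_q-V[\mathcal W_\mp(v),\mathcal G_\mp(u)]_q-(q-q^{-1})\big(\mathcal W_\pm(u)\mathcal G_\mp(v)-\mathcal W_\pm(v)\mathcal G_\mp(u)\big)+\rho\big(U\mathcal W_\mp(u)-V\mathcal W_\mp(v)-\mathcal W_\pm(u)+\mathcal W_\pm(v)\big)=0$;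 (7) $[\mathcal G_\epsilon(u),\mathcal W_\pm(v)]+[\mathcal W_\pm(u),\mathcal G_\epsilon(v)]=0$ for $\epsilon=\pm$; (8) $[\mathcal G_\pm(u),\mathcal G_\pm(v)]=0$; (9) $[\mathcal G_+(u),\mathcal G_-(v)]+[\mathcal G_-(u),\mathcal G_+(v)]=0$. The elements $\Delta_{k+1}$. For $k\in\mathbb Z_+$ let $\bar k=1$ and $[\frac k2]=\frac k2$ if $k$ is even, $\bar k=0$ and $[\frac k2]=\frac{k-1}2$ if $k$ is odd. Put $\mathbb G_{i+1}=\mathcal G_{i+1}+\tilde{\mathcal G}_{i+1}$, $\mathbb W_{ij}=(q-q^{-1})(\mathcal W_{-i}\mathcal W_{j+1}+\mathcal W_{i+1}\mathcal W_{-j})$, $\mathbb F_{ij}=(q-q^{-1})\big((q^2+q^{-2})(\mathcal W_{-i}\mathcal W_{-j}+\mathcal W_{i+1}\mathcal W_{j+1})+\frac1\rho(\mathcal G_{j+1}\tilde{\mathcal G}_{i+1}+\tilde{\mathcal G}_{j+1}\mathcal G_{i+1})\big)$, $c_{k+1}=-\frac{(q+q^{-1})^{k+1}(q^{k+1}+q^{-k-1})}{q^{2k+2}}$, $w^i_m=(-1)^m\frac{(m+i)!}{m!\,i!}(q+q^{-1})^{i+1}q^{-i-2m-1}$ for $m\ge0$, $w^i_{-1}=0$, $e^{(k)}_{ij}=-c_{k+1}^{-1}\sum_{m=0}^{[\frac k2]-\frac{i+j+\bar k}2}w^i_{[\frac k2]-\frac{i+j+\bar k}2-m}\,w^j_m\,q^{-2j-4m-2}$,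 $f^{(k)}_{ij}=c_{k+1}^{-1}\sum_{m=0}^{[\frac k2]-\frac{i+j+\bar k-1}2}w^i_{[\frac k2]-\frac{i+j+\bar k-1}2-m}\,(w^j_m+w^j_{m-1})\,q^{-2j-4m}$, $d^{(k)}_l=-c_{k+1}^{-1}w^{2l+1-\bar k}_{[\frac k2]-l}(1+q^{-2k-2})$, $$\Delta_{k+1}=\mathbb G_{k+1}+\sum_{l=0}^{[\frac k2]-1}d^{(k)}_l\mathbb G_{2(l+1)-\bar k}+\sum_{l=0}^{[\frac k2]}\sum_{i+j=2l+1-\bar k}f^{(k)}_{ij}\mathbb W_{ij}+\sum_{l=0}^{[\frac k2]-\bar k}\sum_{i+j=2l+\bar k}e^{(k)}_{ij}\mathbb F_{ij}.$$ The quotient. Let $\delta_{k+1}\in\mathbb K$ ($k\in\mathbb Z_+$) be fixed scalars. $\tilde{\mathcal A}_q^{\{\delta\}}$ is the quotient of $\mathcal A_q$ by the ideal generated by the relations $\Delta_{k+1}=2\delta_{k+1}$ for all $k\in\mathbb Z_+$. Generators of $\mathcal A_q$ and their images in the quotient are denoted by the same symbols.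
   Formalization: The field K is assumed to have characteristic different from 2; in characteristic 2 the claim fails, since sending all W's to 0 and both G_{k+1} and its tilde counterpart to x_k maps the quotient onto a polynomial ring. *)

theory Defs
  imports
    "HOL-Library.Poly_Mapping"
    "HOL-Computational_Algebra.Formal_Laurent_Series"
    "HOL-Algebra.Generated_Rings"
    "HOL-Algebra.Algebraic_Closure_Type"
begin

section \<open>Free associative algebras\<close>

text \<open>
  The free monoid on \<open>'a\<close>, written additively so that the convolution product of
  \<^theory>\<open>HOL-Library.Poly_Mapping\<close> becomes the multiplication of the free algebra.
\<close>

datatype 'a free_monoid = Word "'a list"

instantiation free_monoid :: (type) monoid_add
begin

definition zero_free_monoid :: "'a free_monoid" where
  "zero_free_monoid = Word []"

fun plus_free_monoid :: "'a free_monoid \<Rightarrow> 'a free_monoid \<Rightarrow> 'a free_monoid" where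
  "plus_free_monoid (Word xs) (Word ys) = Word (xs @ ys)"

instance
proof
  fix a b c :: "'a free_monoid"
  show "a + b + c = a + (b + c)" by (cases a; cases b; cases c) simp
  show "0 + a = a" by (cases a) (simp add: zero_free_monoid_def)
  show "a + 0 = a" by (cases a) (simp add: zero_free_monoid_def)
qed

end

type_synonym ('x, 'k) free_algebra = "'x free_monoid \<Rightarrow>\<^sub>0 'k"

definition scalar :: "'k::field \<Rightarrow> ('x, 'k) free_algebra" where
  "scalar c = Poly_Mapping.single 0 c"

definition fgen :: "'x \<Rightarrow> ('x, 'k::field) free_algebra" where
  "fgen x = Poly_Mapping.single (Word [x]) 1"


section \<open>Formal series in two variables\<close>

text \<open>
  The indeterminates \<open>u\<close> and \<open>v\<close> enter the relations only through \<open>U\<close> and \<open>V\<close>, which are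
  algebraically independent and are used as formal variables.  Elements of \<open>'a fls fls\<close> are
  Laurent series in \<open>V\<inverse>\<close> (outer variable) whose coefficients are Laurent series in \<open>U\<inverse>\<close>
  (inner variable).
\<close>

definition U :: "'a::ring_1 fls fls" where
  "U = fls_const fls_X_inv"

definition V :: "'a::ring_1 fls fls" where
  "V = fls_X_inv"

text \<open>The series \<open>\<Sum>\<^sub>k a\<^sub>k U\<^bsup>-k-1\<^esup>\<close> and \<open>\<Sum>\<^sub>k a\<^sub>k V\<^bsup>-k-1\<^esup>\<close>.\<close>

definition series_u :: "(nat \<Rightarrow> 'a::ring_1) \<Rightarrow> 'a fls fls" where
  "series_u a = fls_const (fls_X * fps_to_fls (Abs_fps a))"

definition series_v :: "(nat \<Rightarrow> 'a::ring_1) \<Rightarrow> 'a fls fls" where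
  "series_v a = fls_X * fps_to_fls (Abs_fps (\<lambda>k. fls_const (a k)))"

definition coefficients :: "'a::zero fls fls \<Rightarrow> 'a set" where
  "coefficients f = {fls_nth (fls_nth f n) m | n m. True}"

definition const :: "'k::field \<Rightarrow> ('x, 'k) free_algebra fls fls" where
  "const c = fls_const (fls_const (scalar c))"

definition comm :: "'a::ring_1 \<Rightarrow> 'a \<Rightarrow> 'a" where
  "comm x y = x * y - y * x"

definition qcomm :: "'k::field \<Rightarrow> ('x, 'k) free_algebra fls fls \<Rightarrow>
    ('x, 'k) free_algebra fls fls \<Rightarrow> ('x, 'k) free_algebra fls fls" where
  "qcomm q x y = const q * x * y - const (inverse q) * y * x"


section \<open>The algebra \<open>\<A>\<^sub>q\<close>\<close>

text \<open>
  \<open>W n\<close> (\<open>n\<close> an integer) is \<open>\<W>\<^sub>n\<close>, so that \<open>\<W>\<^bsub>-k\<^esub>\<close> and \<open>\<W>\<^bsub>k+1\<^esub>\<close> together exhaust the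
  constructor; \<open>G k\<close> and \<open>Gt k\<close> are \<open>\<G>\<^bsub>k+1\<^esub>\<close> and its counterpart with a tilde.
\<close>

datatype gen = W int | G nat | Gt nat

type_synonym 'k falg = "(gen, 'k) free_algebra"

datatype sgn = Plus | Minus

fun opp :: "sgn \<Rightarrow> sgn" where
  "opp Plus = Minus"
| "opp Minus = Plus"

fun Wcoeff :: "sgn \<Rightarrow> nat \<Rightarrow> 'k::field falg" where
  "Wcoeff Plus k = fgen (W (- int k))"
| "Wcoeff Minus k = fgen (W (int k + 1))"

fun Gcoeff :: "sgn \<Rightarrow> nat \<Rightarrow> 'k::field falg" where
  "Gcoeff Plus k = fgen (G k)"
| "Gcoeff Minus k = fgen (Gt k)"

definition Wu :: "sgn \<Rightarrow> 'k::field falg fls fls" where "Wu s = series_u (Wcoeff s)"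
definition Wv :: "sgn \<Rightarrow> 'k::field falg fls fls" where "Wv s = series_v (Wcoeff s)"
definition Gu :: "sgn \<Rightarrow> 'k::field falg fls fls" where "Gu s = series_u (Gcoeff s)"
definition Gv :: "sgn \<Rightarrow> 'k::field falg fls fls" where "Gv s = series_v (Gcoeff s)"

text \<open>
  Each series below is the difference of the two sides of a defining relation; \<open>s\<close> is the sign
  in the upper position of \<open>\<plusminus>\<close>.  The relations \<open>rel3\<close> and \<open>rel4\<close> are multiplied by \<open>U - V\<close>.
\<close>

definition rel1 :: "sgn \<Rightarrow> 'k::field falg fls fls" where
  "rel1 s = comm (Wu s) (Wv s)"

definition rel2 :: "'k::field falg fls fls" where
  "rel2 = comm (Wu Plus) (Wv Minus) + comm (Wu Minus) (Wv Plus)"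

definition rel3 :: "'k::field \<Rightarrow> 'k \<Rightarrow> sgn \<Rightarrow> 'k falg fls fls" where
  "rel3 q \<rho> s =
     (U - V) * comm (Wu s) (Wv (opp s))
     - (const ((q - inverse q) / (\<rho> * (q + inverse q)))
          * (Gu s * Gv (opp s) - Gv s * Gu (opp s))
        + const (1 / (q + inverse q)) * (Gu s - Gu (opp s) + Gv (opp s) - Gv s))"

definition rel4 :: "'k::field \<Rightarrow> 'k \<Rightarrow> sgn \<Rightarrow> 'k falg fls fls" where
  "rel4 q \<rho> s =
     (U - V) * (Wu s * Wv s - Wu (opp s) * Wv (opp s)
        + const (1 / (\<rho> * (q^2 - inverse q ^ 2))) * comm (Gu s) (Gv (opp s)))
     + (1 - U * V) * (Wu s * Wv (opp s) - Wv s * Wu (opp s))"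

definition rel5 :: "'k::field \<Rightarrow> 'k \<Rightarrow> sgn \<Rightarrow> 'k falg fls fls" where
  "rel5 q \<rho> s =
     U * qcomm q (Gv (opp s)) (Wu s) - V * qcomm q (Gu (opp s)) (Wv s)
     - const (q - inverse q) * (Wu (opp s) * Gv (opp s) - Wv (opp s) * Gu (opp s))
     + const \<rho> * (U * Wu s - V * Wv s - Wu (opp s) + Wv (opp s))"

definition rel6 :: "'k::field \<Rightarrow> 'k \<Rightarrow> sgn \<Rightarrow> 'k falg fls fls" where
  "rel6 q \<rho> s =
     U * qcomm q (Wu (opp s)) (Gv (opp s)) - V * qcomm q (Wv (opp s)) (Gu (opp s))
     - const (q - inverse q) * (Wu s * Gv (opp s) - Wv s * Gu (opp s))
     + const \<rho> * (U * Wu (opp s) - V * Wv (opp s) - Wu s + Wv s)"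

definition rel7 :: "sgn \<Rightarrow> sgn \<Rightarrow> 'k::field falg fls fls" where
  "rel7 \<epsilon> s = comm (Gu \<epsilon>) (Wv s) + comm (Wu s) (Gv \<epsilon>)"

definition rel8 :: "sgn \<Rightarrow> 'k::field falg fls fls" where
  "rel8 s = comm (Gu s) (Gv s)"

definition rel9 :: "'k::field falg fls fls" where
  "rel9 = comm (Gu Plus) (Gv Minus) + comm (Gu Minus) (Gv Plus)"

definition relations :: "'k::field \<Rightarrow> 'k \<Rightarrow> 'k falg fls fls set" where
  "relations q \<rho> =
     {rel1 s | s. True} \<union> {rel2} \<union> {rel3 q \<rho> s | s. True} \<union> {rel4 q \<rho> s | s. True}
     \<union> {rel5 q \<rho> s | s. True} \<union> {rel6 q \<rho> s | s. True} \<union> {rel7 \<epsilon> s | \<epsilon> s. True}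
     \<union> {rel8 s | s. True} \<union> {rel9}"

definition Aq_ideal :: "'k::field \<Rightarrow> 'k \<Rightarrow> 'k falg set" where
  "Aq_ideal q \<rho> = Idl\<^bsub>ring_of_type_algebra\<^esub> (\<Union>r\<in>relations q \<rho>. coefficients r)"

definition Aq :: "'k::field \<Rightarrow> 'k \<Rightarrow> 'k falg set ring" where
  "Aq q \<rho> = ring_of_type_algebra Quot Aq_ideal q \<rho>"

text \<open>The canonical map from the free algebra to \<open>\<A>\<^sub>q\<close>.\<close>

definition Aq_proj :: "'k::field \<Rightarrow> 'k \<Rightarrow> 'k falg \<Rightarrow> 'k falg set" where
  "Aq_proj q \<rho> x = Aq_ideal q \<rho> +>\<^bsub>ring_of_type_algebra\<^esub> x"


section \<open>The elements \<open>\<Delta>\<^bsub>k+1\<^esub>\<close>\<close>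

text \<open>
  All elements are given by representatives in the free algebra.  The number \<open>[k/2]\<close> is
  \<^term>\<open>k div 2\<close>.
\<close>

definition kbar :: "nat \<Rightarrow> nat" where
  "kbar k = (if even k then 1 else 0)"

definition GG :: "nat \<Rightarrow> 'k::field falg" where \<comment> \<open>\<open>GG i\<close> carries the subscript \<open>i + 1\<close>\<close>
  "GG i = fgen (G i) + fgen (Gt i)"

definition WW :: "'k::field \<Rightarrow> nat \<Rightarrow> nat \<Rightarrow> 'k falg" where
  "WW q i j = scalar (q - inverse q) *
     (fgen (W (- int i)) * fgen (W (int j + 1)) + fgen (W (int i + 1)) * fgen (W (- int j)))"

definition FF :: "'k::field \<Rightarrow> 'k \<Rightarrow> nat \<Rightarrow> nat \<Rightarrow> 'k falg" where
  "FF q \<rho> i j = scalar (q - inverse q) *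
     (scalar (q^2 + inverse q ^ 2) *
        (fgen (W (- int i)) * fgen (W (- int j)) + fgen (W (int i + 1)) * fgen (W (int j + 1)))
      + scalar (1 / \<rho>) * (fgen (G j) * fgen (Gt i) + fgen (Gt j) * fgen (G i)))"

definition c_coeff :: "'k::field \<Rightarrow> nat \<Rightarrow> 'k" where \<comment> \<open>\<open>c_coeff q k\<close> carries the subscript \<open>k + 1\<close>\<close>
  "c_coeff q k = - ((q + inverse q)^(k+1) * (q^(k+1) + inverse q ^ (k+1)) / q^(2*k+2))"

text \<open>
  The quotient of factorials is an integer, mapped to the field as such; this matters in
  positive characteristic.  Only \<open>m \<ge> -1\<close> is ever used.
\<close>

definition w_coeff :: "'k::field \<Rightarrow> nat \<Rightarrow> int \<Rightarrow> 'k" where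
  "w_coeff q i m = (if m < 0 then 0 else
     (-1)^nat m * of_nat ((nat m + i) choose i) * (q + inverse q)^(i+1)
       * q powi (- int i - 2*m - 1))"

definition e_coeff :: "'k::field \<Rightarrow> nat \<Rightarrow> nat \<Rightarrow> nat \<Rightarrow> 'k" where
  "e_coeff q k i j =
     (let N = int (k div 2) - (int i + int j + int (kbar k)) div 2
      in - inverse (c_coeff q k) *
           (\<Sum>m\<in>{0..N}. w_coeff q i (N - m) * w_coeff q j m * q powi (- 2 * int j - 4*m - 2)))"

definition f_coeff :: "'k::field \<Rightarrow> nat \<Rightarrow> nat \<Rightarrow> nat \<Rightarrow> 'k" where
  "f_coeff q k i j =
     (let N = int (k div 2) - (int i + int j + int (kbar k) - 1) div 2
      in inverse (c_coeff q k) *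
           (\<Sum>m\<in>{0..N}. w_coeff q i (N - m) * (w_coeff q j m + w_coeff q j (m - 1)) * q powi (- 2 * int j - 4*m)))"

definition d_coeff :: "'k::field \<Rightarrow> nat \<Rightarrow> nat \<Rightarrow> 'k" where
  "d_coeff q k l = - inverse (c_coeff q k) * w_coeff q (2*l + 1 - kbar k) (int (k div 2) - int l)
     * (1 + q powi (- 2 * int k - 2))"

text \<open>
  \<open>\<Delta> q \<rho> k\<close> carries the subscript \<open>k + 1\<close>, and \<^term>\<open>GG (2*(l+1) - kbar k - 1)\<close> the subscript
  \<^term>\<open>2*(l+1) - kbar k\<close>.  In the last sum \<open>l\<close> is not bounded by \<^term>\<open>k div 2 - kbar k\<close>, as
  truncated subtraction would make that sum nonempty for \<^term>\<open>k = 0\<close>.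
\<close>

definition \<Delta> :: "'k::field \<Rightarrow> 'k \<Rightarrow> nat \<Rightarrow> 'k falg" where
  "\<Delta> q \<rho> k =
     GG k
     + (\<Sum>l\<in>{l. l < k div 2}. scalar (d_coeff q k l) * GG (2*(l+1) - kbar k - 1))
     + (\<Sum>l\<in>{l. l \<le> k div 2}. \<Sum>(i,j)\<in>{(i,j). i + j = 2*l + 1 - kbar k}.
          scalar (f_coeff q k i j) * WW q i j)
     + (\<Sum>l\<in>{l. l + kbar k \<le> k div 2}. \<Sum>(i,j)\<in>{(i,j). i + j = 2*l + kbar k}.
          scalar (e_coeff q k i j) * FF q \<rho> i j)"


section \<open>The quotient of \<open>\<A>\<^sub>q\<close>\<close>

text \<open>The scalar \<open>\<delta> k\<close> carries the subscript \<open>k + 1\<close>.\<close>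

definition Atilde_ideal :: "'k::field \<Rightarrow> 'k \<Rightarrow> (nat \<Rightarrow> 'k) \<Rightarrow> 'k falg set set" where
  "Atilde_ideal q \<rho> \<delta> =
     Idl\<^bsub>Aq q \<rho>\<^esub> {Aq_proj q \<rho> (\<Delta> q \<rho> k - scalar (2 * \<delta> k)) | k. True}"

definition Atilde :: "'k::field \<Rightarrow> 'k \<Rightarrow> (nat \<Rightarrow> 'k) \<Rightarrow> 'k falg set set ring" where
  "Atilde q \<rho> \<delta> = Aq q \<rho> Quot Atilde_ideal q \<rho> \<delta>"

text \<open>The canonical map from the free algebra to the quotient.\<close>

definition Atilde_proj :: "'k::field \<Rightarrow> 'k \<Rightarrow> (nat \<Rightarrow> 'k) \<Rightarrow> 'k falg \<Rightarrow> 'k falg set set" where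
  "Atilde_proj q \<rho> \<delta> x = Atilde_ideal q \<rho> \<delta> +>\<^bsub>Aq q \<rho>\<^esub> Aq_proj q \<rho> x"

text \<open>
  The unital subalgebra generated by \<open>S\<close>: the subring generated by \<open>S\<close> together with the image
  \<open>\<iota>\<close> of the ground field.
\<close>

definition generated_subalgebra :: "'a ring \<Rightarrow> ('k \<Rightarrow> 'a) \<Rightarrow> 'a set \<Rightarrow> 'a set" where
  "generated_subalgebra R \<iota> S = generate_ring R (\<iota> ` UNIV \<union> S)"

text \<open>
  The theorem needs a ground field in which \<open>2 \<noteq> 0\<close>.  In characteristic 2, sending
  every \<open>\<W>\<^sub>n\<close> to \<open>0\<close>, and \<open>\<G>\<^bsub>k+1\<^esub>\<close> and its counterpart with a tilde both to \<open>x\<^sub>k\<close>, respects the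
  defining relations and sends each \<open>\<Delta>\<^bsub>k+1\<^esub>\<close> to \<open>0 = 2\<delta>\<^bsub>k+1\<^esub>\<close>; so the quotient maps
  onto a polynomial ring in which the images of \<open>\<W>\<^sub>0\<close> and \<open>\<W>\<^sub>1\<close> generate only the constants.
\<close>

end

theory Submission
  imports Defs
begin

text \<open>
  Extracting the coefficients of \<open>U\<^sup>0 V\<^bsup>-k-1\<^esup>\<close> from (3) and (5) gives
  \<open>[\<W>\<^sub>0, \<W>\<^bsub>k+1\<^esub>] = (\<G>t\<^bsub>k+1\<^esub> - \<G>\<^bsub>k+1\<^esub>) / (q + q\<inverse>)\<close>,
  \<open>[\<G>t\<^bsub>k+1\<^esub>, \<W>\<^sub>0]\<^sub>q = \<rho> (\<W>\<^bsub>-k-1\<^esub> - \<W>\<^bsub>k+1\<^esub>)\<close> and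
  \<open>[\<G>\<^bsub>k+1\<^esub>, \<W>\<^sub>1]\<^sub>q = \<rho> (\<W>\<^bsub>k+2\<^esub> - \<W>\<^bsub>-k\<^esub>)\<close>, where \<open>\<G>t\<close> stands for \<open>\<G>\<close> with a tilde.
  Moreover \<open>\<Delta>\<^bsub>k+1\<^esub> - \<G>\<^bsub>k+1\<^esub> - \<G>t\<^bsub>k+1\<^esub>\<close> is a polynomial in the \<open>\<W>\<^bsub>-i\<^esub>\<close>, \<open>\<W>\<^bsub>i+1\<^esub>\<close>
  with \<open>i \<le> k\<close> and the \<open>\<G>\<^bsub>i+1\<^esub>\<close>, \<open>\<G>t\<^bsub>i+1\<^esub>\<close> with \<open>i < k\<close>.  Hence, by induction on \<open>k\<close>,
  sum and difference of \<open>\<G>\<^bsub>k+1\<^esub>\<close> and \<open>\<G>t\<^bsub>k+1\<^esub>\<close>, and then \<open>\<W>\<^bsub>-k-1\<^esub>\<close> and \<open>\<W>\<^bsub>k+2\<^esub>\<close>, lie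
  in the subalgebra generated by \<open>\<W>\<^sub>0\<close> and \<open>\<W>\<^sub>1\<close>.
\<close>

section \<open>Coefficients of the defining relations\<close>

unbundle fps_syntax

lemma nth_nth_series_u:
  "series_u a $$ n $$ m = (if n = 0 \<and> m \<ge> 1 then a (nat (m - 1)) else 0)"
  by (auto simp: series_u_def fls_X_times_conv_shift)

lemma nth_series_v:
  "series_v a $$ n = (if n \<ge> 1 then fls_const (a (nat (n - 1))) else 0)"
  by (auto simp: series_v_def fls_X_times_conv_shift)

text \<open>The variables commute with everything but the coefficients need not commute with each
  other, so the opposite order of factors is treated separately below.\<close>

lemma nth_nth_series_u_mult_series_v:
  "(series_u a * series_v b) $$ n $$ m =
     (if n \<ge> 1 \<and> m \<ge> 1 then a (nat (m - 1)) * b (nat (n - 1)) else 0)"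
  unfolding series_u_def fls_mult_const_nth nth_series_v
  by (auto simp: fls_X_times_conv_shift)

lemma nth_nth_series_v_mult_series_u:
  "(series_v b * series_u a) $$ n $$ m =
     (if n \<ge> 1 \<and> m \<ge> 1 then b (nat (n - 1)) * a (nat (m - 1)) else 0)"
  unfolding series_u_def fls_mult_const_nth nth_series_v
  by (auto simp: fls_X_times_conv_shift)

lemma nth_nth_U_mult: "(U * f) $$ n $$ m = f $$ n $$ (m + 1)"
  by (simp add: U_def fls_X_inv_times_conv_shift)

lemma nth_nth_V_mult: "(V * f) $$ n $$ m = f $$ (n + 1) $$ m"
  by (simp add: V_def fls_X_inv_times_conv_shift)

lemma nth_nth_const_mult: "(const c * f) $$ n $$ m = scalar c * f $$ n $$ m"
  by (simp add: const_def)

lemmas nth_nth_simps =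
  nth_nth_series_u nth_series_v nth_nth_series_u_mult_series_v nth_nth_series_v_mult_series_u
  nth_nth_U_mult nth_nth_V_mult nth_nth_const_mult

text \<open>Every \<open>series_u\<close> starts at the first power of the inverse of U. So at
  U-degree 0 a product survives only with an extra factor U, which picks out the leading
  coefficient; of the linear terms only those in V remain.\<close>

lemma rel3_coefficient:
  "rel3 q \<rho> Plus $$ (int k + 1) $$ 0 =
     comm (fgen (W 0)) (fgen (W (int k + 1))) - scalar (1 / (q + inverse q)) * (fgen (Gt k) - fgen (G k))"
  by (simp add: rel3_def comm_def Wu_def Wv_def Gu_def Gv_def left_diff_distrib nth_nth_simps)

text \<open>Same mechanism; the shifted index \<open>Suc k\<close> comes from the factor V in the
  linear term.\<close>

lemma rel5_coefficient:
  "rel5 q \<rho> s $$ (int k + 1) $$ 0 =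
     scalar q * (Gcoeff (opp s) k * Wcoeff s 0) - scalar (inverse q) * (Wcoeff s 0 * Gcoeff (opp s) k)
     + scalar \<rho> * (Wcoeff (opp s) k - Wcoeff s (Suc k))"
  by (simp add: rel5_def qcomm_def Wu_def Wv_def Gu_def Gv_def mult.assoc nth_nth_simps
      nat_add_distrib)


section \<open>Subalgebras of the free algebra\<close>

lemma scalar_mult_scalar: "scalar a * scalar b = scalar (a * b)"
  by (simp add: scalar_def mult_single)

lemma scalar_1 [simp]: "scalar 1 = 1"
  by (simp add: scalar_def)

lemma scalar_numeral: "scalar (numeral n) = numeral n"
  by (simp add: scalar_def single_numeral)

text \<open>Used for preimages of subalgebras of the quotient, so that the main argument runs in the
  free algebra.\<close>

locale subalgebra =
  fixes S :: "('x, 'k::field) free_algebra set"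
  assumes diff: "x \<in> S \<Longrightarrow> y \<in> S \<Longrightarrow> x - y \<in> S"
    and mult: "x \<in> S \<Longrightarrow> y \<in> S \<Longrightarrow> x * y \<in> S"
    and scalar: "scalar c \<in> S"
begin

lemma zero: "0 \<in> S"
  using scalar[of 0] by (simp add: scalar_def)

lemma add: "x \<in> S \<Longrightarrow> y \<in> S \<Longrightarrow> x + y \<in> S"
  using diff[of x "0 - y"] diff[of 0 y] zero by simp

lemma sum: "(\<And>a. a \<in> A \<Longrightarrow> f a \<in> S) \<Longrightarrow> sum f A \<in> S"
  by (induction A rule: infinite_finite_induct) (auto intro: zero add)

lemma scalar_multD: "scalar c * x \<in> S \<Longrightarrow> c \<noteq> 0 \<Longrightarrow> x \<in> S"
  using mult[OF scalar[of "inverse c"], of "scalar c * x"]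
  by (simp add: mult.assoc[symmetric] scalar_mult_scalar)

lemma diffD1: "x - y \<in> S \<Longrightarrow> y \<in> S \<Longrightarrow> x \<in> S"
  using add[of "x - y" y] by simp

lemma diffD2: "x - y \<in> S \<Longrightarrow> x \<in> S \<Longrightarrow> y \<in> S"
  using diff[of x "x - y"] by simp

lemma addD1: "x + y \<in> S \<Longrightarrow> y \<in> S \<Longrightarrow> x \<in> S"
  using diff[of "x + y" y] by simp

lemma addD2: "x + y \<in> S \<Longrightarrow> x \<in> S \<Longrightarrow> y \<in> S"
  using diff[of "x + y" x] by simp

lemma single_Word:
  assumes "\<And>x. fgen x \<in> S"
  shows "Poly_Mapping.single (Word xs) c \<in> S"
proof (induction xs)
  case Nil
  show ?case using scalar[of c] by (simp add: scalar_def zero_free_monoid_def)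
next
  case (Cons x xs)
  have "Poly_Mapping.single (Word (x # xs)) c = fgen x * Poly_Mapping.single (Word xs) c"
    by (simp add: fgen_def mult_single)
  then show ?case using mult[OF assms Cons] by simp
qed

lemma UNIV_if_fgen:
  assumes "\<And>x. fgen x \<in> S"
  shows "S = UNIV"
proof -
  have "f \<in> S" for f
  proof (induction f rule: update_induct)
    case const
    show ?case by (rule zero)
  next
    case (update f a b)
    \<comment> \<open>The word \<open>a\<close> lies outside the support of \<open>f\<close>, so
      updating there is adding a monomial.\<close>
    have "Poly_Mapping.update a b f = f + Poly_Mapping.single a b"
      using update(1)
      by (intro poly_mapping_eqI)
        (auto simp: lookup_update lookup_add lookup_single in_keys_iff when_def)
    moreover have "Poly_Mapping.single a b \<in> S"
      using single_Word[OF assms] by (cases a) simp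
    ultimately show ?case using add update(3) by simp
  qed
  then show ?thesis by blast
qed

end


section \<open>Generation by \<open>\<W>\<^sub>0\<close> and \<open>\<W>\<^sub>1\<close>\<close>

lemma GG_mem_if_lower:
  fixes S :: "'k::field falg set"
  assumes "subalgebra S"
    and W: "\<And>i. i \<le> k \<Longrightarrow> fgen (W (- int i)) \<in> S \<and> fgen (W (int i + 1)) \<in> S"
    and G: "\<And>i. i < k \<Longrightarrow> fgen (G i) \<in> S \<and> fgen (Gt i) \<in> S"
    and D: "\<Delta> q \<rho> k \<in> S"
  shows "GG k \<in> S"
proof -
  interpret subalgebra S by fact
  have d: "scalar (d_coeff q k l) * GG (2*(l+1) - kbar k - 1) \<in> S" if "l < k div 2" for l
  proof -
    have "2*(l+1) - kbar k - 1 < k" using that by (auto simp: kbar_def elim!: evenE oddE)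
    then show ?thesis unfolding GG_def by (intro mult scalar add) (auto dest: G)
  qed
  have f: "scalar (f_coeff q k i j) * WW q i j \<in> S"
    if "l \<le> k div 2" "i + j = 2*l + 1 - kbar k" for l i j
  proof -
    have "i \<le> k" "j \<le> k" using that by (auto simp: kbar_def split: if_splits elim!: evenE oddE)
    then show ?thesis unfolding WW_def by (intro mult scalar add) (auto dest: W)
  qed
  have e: "scalar (e_coeff q k i j) * FF q \<rho> i j \<in> S"
    if "l + kbar k \<le> k div 2" "i + j = 2*l + kbar k" for l i j
  proof -
    \<comment> \<open>Here \<open>i + j < k\<close>, whereas the \<open>WW\<close> terms allow
      \<open>i + j = k\<close>. Strictness matters because \<open>FF\<close> contains the G
      generators.\<close>
    have "i < k" "j < k" using that by (auto simp: kbar_def split: if_splits elim!: evenE oddE)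
    then show ?thesis unfolding FF_def by (intro mult scalar add) (simp_all add: W G)
  qed
  show ?thesis
    by (rule addD1, rule addD1, rule addD1, rule D[unfolded \<Delta>_def])
      (auto intro!: sum d[simplified] e f[simplified])
qed

lemma subalgebra_eq_UNIV:
  fixes S :: "'k::field falg set"
  assumes "subalgebra S"
    and "(2::'k) \<noteq> 0" and q: "q + inverse q \<noteq> 0" and "\<rho> \<noteq> 0"
    and rels: "\<And>r. r \<in> relations q \<rho> \<Longrightarrow> coefficients r \<subseteq> S"
    and \<Delta>: "\<And>k. \<Delta> q \<rho> k \<in> S"
    and W0: "fgen (W 0) \<in> S" and W1: "fgen (W 1) \<in> S"
  shows "S = UNIV"
proof -
  interpret subalgebra S by fact
  have coeff: "r $$ n $$ m \<in> S" if "r \<in> relations q \<rho>" for r n m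
    using rels[OF that] by (auto simp: coefficients_def)
  have gens: "fgen (W (- int k)) \<in> S \<and> fgen (W (int k + 1)) \<in> S \<and> fgen (G k) \<in> S \<and> fgen (Gt k) \<in> S"
    for k
  proof (induction k rule: less_induct)
    case (less k)
    \<comment> \<open>The W generators come first, since \<open>\<Delta> q \<rho> k\<close> may
      involve them at the top index \<open>k\<close>.\<close>
    have W: "fgen (W (- int k)) \<in> S \<and> fgen (W (int k + 1)) \<in> S"
    proof (cases k)
      case 0
      then show ?thesis using W0 W1 by simp
    next
      case (Suc j)
      have Gc: "Gcoeff s j \<in> S" and Wc: "Wcoeff s j \<in> S" and W0c: "Wcoeff s 0 \<in> S" for s
        using less.IH[of j] Suc W0 W1 by (cases s; simp)+
      have "Wcoeff s k \<in> S" for s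
      proof -
        have "rel5 q \<rho> s \<in> relations q \<rho>" unfolding relations_def by blast
        note coeff[OF this, of "int j + 1" 0, unfolded rel5_coefficient]
        moreover have "scalar q * (Gcoeff (opp s) j * Wcoeff s 0)
            - scalar (inverse q) * (Wcoeff s 0 * Gcoeff (opp s) j) \<in> S"
          by (intro diff mult scalar Gc W0c)
        ultimately have "scalar \<rho> * (Wcoeff (opp s) j - Wcoeff s k) \<in> S"
          unfolding Suc by (rule addD2)
        then have "Wcoeff (opp s) j - Wcoeff s k \<in> S"
          using \<open>\<rho> \<noteq> 0\<close> by (rule scalar_multD)
        then show ?thesis using Wc by (rule diffD2)
      qed
      from this[of Plus] this[of Minus] show ?thesis by simp
    qed
    have "fgen (W (- int i)) \<in> S \<and> fgen (W (int i + 1)) \<in> S" if "i \<le> k" for i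
      using that W less.IH[of i] by (cases "i = k") auto
    then have sum: "fgen (G k) + fgen (Gt k) \<in> S"
      using GG_mem_if_lower[OF \<open>subalgebra S\<close> _ _ \<Delta>, of k] less.IH by (simp add: GG_def)
    have "rel3 q \<rho> Plus \<in> relations q \<rho>" unfolding relations_def by blast
    note coeff[OF this, of "int k + 1" 0, unfolded rel3_coefficient]
    moreover have "comm (fgen (W 0)) (fgen (W (int k + 1))) \<in> S"
      unfolding comm_def using W W0 by (intro diff mult) auto
    ultimately have "scalar (1 / (q + inverse q)) * (fgen (Gt k) - fgen (G k)) \<in> S"
      by (rule diffD2)
    then have "fgen (Gt k) - fgen (G k) \<in> S"
      by (rule scalar_multD) (simp add: q)
    \<comment> \<open>Sum minus difference is twice \<open>fgen (G k)\<close>; characteristic 2 is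
      excluded for this step.\<close>
    from diff[OF sum this] have "scalar 2 * fgen (G k) \<in> S"
      by (simp add: scalar_numeral mult_2 algebra_simps)
    then have "fgen (G k) \<in> S" using \<open>2 \<noteq> 0\<close> by (rule scalar_multD)
    with sum W show ?case by (auto dest: addD2)
  qed
  have "fgen x \<in> S" for x
  proof (cases x)
    case (W n)
    have "n = - int (nat (- n)) \<or> n = int (nat (n - 1)) + 1" by linarith
    then show ?thesis using gens W by metis
  qed (use gens in auto)
  then show ?thesis by (rule UNIV_if_fgen)
qed


section \<open>Transfer to the quotient\<close>

lemma ring_of_type_algebra_ring: "ring (ring_of_type_algebra :: 'a::ring_1 ring)"
proof -
  have "\<exists>y. x + y = 0" for x :: 'a
    using add.right_inverse by blast
  then show ?thesis
    unfolding ring_of_type_algebra_def using add.right_inverse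
    by unfold_locales (auto simp: algebra_simps Units_def)
qed

lemma ring_of_type_algebra_simps:
  "carrier ring_of_type_algebra = UNIV"
  "x \<oplus>\<^bsub>ring_of_type_algebra\<^esub> y = x + y"
  "x \<otimes>\<^bsub>ring_of_type_algebra\<^esub> y = x * y"
  "\<zero>\<^bsub>ring_of_type_algebra\<^esub> = 0"
  "\<one>\<^bsub>ring_of_type_algebra\<^esub> = 1"
  by (simp_all add: ring_of_type_algebra_def)

lemma ideal_Aq_ideal: "ideal (Aq_ideal q \<rho>) ring_of_type_algebra"
  unfolding Aq_ideal_def
  by (intro ring.genideal_ideal ring_of_type_algebra_ring) (simp add: ring_of_type_algebra_simps)

lemma ring_Aq: "ring (Aq q \<rho>)"
  unfolding Aq_def by (rule ideal.quotient_is_ring[OF ideal_Aq_ideal])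

lemma Aq_proj_hom: "Aq_proj q \<rho> \<in> ring_hom ring_of_type_algebra (Aq q \<rho>)"
  using ideal.rcos_ring_hom[OF ideal_Aq_ideal, of q \<rho>]
  unfolding Aq_def Aq_proj_def[abs_def] .

lemma Aq_proj_surj: "range (Aq_proj q \<rho>) = carrier (Aq q \<rho>)"
  by (auto simp: Aq_def Aq_proj_def FactRing_def A_RCOSETS_def' ring_of_type_algebra_simps)

lemma ideal_Atilde_ideal: "ideal (Atilde_ideal q \<rho> \<delta>) (Aq q \<rho>)"
  unfolding Atilde_ideal_def using Aq_proj_surj by (intro ring.genideal_ideal ring_Aq) blast

lemma ring_Atilde: "ring (Atilde q \<rho> \<delta>)"
  unfolding Atilde_def by (rule ideal.quotient_is_ring[OF ideal_Atilde_ideal])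

lemma Atilde_proj_hom: "Atilde_proj q \<rho> \<delta> \<in> ring_hom ring_of_type_algebra (Atilde q \<rho> \<delta>)"
  using ring_hom_trans[OF Aq_proj_hom ideal.rcos_ring_hom[OF ideal_Atilde_ideal], of q \<rho> \<delta>]
  unfolding Atilde_def Atilde_proj_def[abs_def] comp_def .

lemma Atilde_proj_surj: "range (Atilde_proj q \<rho> \<delta>) = carrier (Atilde q \<rho> \<delta>)"
  by (auto simp: Atilde_def Atilde_proj_def FactRing_def A_RCOSETS_def' Aq_proj_surj[symmetric])

lemma Atilde_proj_eq_zero:
  assumes "Aq_proj q \<rho> x \<in> Atilde_ideal q \<rho> \<delta>"
  shows "Atilde_proj q \<rho> \<delta> x = \<zero>\<^bsub>Atilde q \<rho> \<delta>\<^esub>"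
proof -
  interpret ideal "Atilde_ideal q \<rho> \<delta>" "Aq q \<rho>" by (rule ideal_Atilde_ideal)
  show ?thesis unfolding Atilde_proj_def Atilde_def FactRing_def using a_rcos_const[OF assms] by simp
qed

text \<open>Such an element already vanishes in \<open>Aq q \<rho>\<close>, and zero belongs to the
  second ideal.\<close>

lemma Atilde_proj_coefficient:
  assumes "r \<in> relations q \<rho>" and "x \<in> coefficients r"
  shows "Atilde_proj q \<rho> \<delta> x = \<zero>\<^bsub>Atilde q \<rho> \<delta>\<^esub>"
proof -
  interpret I: ideal "Aq_ideal q \<rho>" ring_of_type_algebra by (rule ideal_Aq_ideal)
  interpret J: ideal "Atilde_ideal q \<rho> \<delta>" "Aq q \<rho>" by (rule ideal_Atilde_ideal)
  have "(\<Union>r\<in>relations q \<rho>. coefficients r) \<subseteq> Aq_ideal q \<rho>"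
    unfolding Aq_ideal_def by (rule I.genideal_self) (simp add: ring_of_type_algebra_simps)
  with assms have "x \<in> Aq_ideal q \<rho>" by blast
  then have "Aq_proj q \<rho> x = \<zero>\<^bsub>Aq q \<rho>\<^esub>"
    unfolding Aq_proj_def Aq_def FactRing_def using I.a_rcos_const by simp
  then show ?thesis 
    using J.additive_subgroup_axioms by (simp add: Atilde_proj_eq_zero additive_subgroup.zero_closed)
qed

lemma Atilde_proj_\<Delta>:
  "Atilde_proj q \<rho> \<delta> (\<Delta> q \<rho> k - scalar (2 * \<delta> k)) = \<zero>\<^bsub>Atilde q \<rho> \<delta>\<^esub>"
proof (rule Atilde_proj_eq_zero)
  have "{Aq_proj q \<rho> (\<Delta> q \<rho> k - scalar (2 * \<delta> k)) | k. True} \<subseteq> Atilde_ideal q \<rho> \<delta>"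
    unfolding Atilde_ideal_def using Aq_proj_surj by (intro ring.genideal_self ring_Aq) blast
  then show "Aq_proj q \<rho> (\<Delta> q \<rho> k - scalar (2 * \<delta> k)) \<in> Atilde_ideal q \<rho> \<delta>" by blast
qed

text \<open>Sums, products and scalars are inherited along \<open>h\<close>; differences reduce to
  these by multiplying with \<open>scalar (- 1)\<close>.\<close>

lemma subalgebra_vimage_generated_subalgebra:
  fixes h :: "('x, 'k::field) free_algebra \<Rightarrow> 'b"
  assumes h: "h \<in> ring_hom ring_of_type_algebra R" and R: "ring R"
  shows "subalgebra (h -` generated_subalgebra R (\<lambda>c. h (scalar c)) T)"
proof -
  let ?B = "generated_subalgebra R (\<lambda>c. h (scalar c)) T"
  have scalar: "h (scalar c) \<in> ?B" for c
    unfolding generated_subalgebra_def by (rule generate_ring.incl) simp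
  have mult: "h (x * y) \<in> ?B" if "h x \<in> ?B" "h y \<in> ?B" for x y
    using generate_ring.eng_mult[OF that[unfolded generated_subalgebra_def]] ring_hom_mult[OF h, of x y]
    by (simp add: generated_subalgebra_def ring_of_type_algebra_simps)
  have add: "h (x + y) \<in> ?B" if "h x \<in> ?B" "h y \<in> ?B" for x y
    using generate_ring.eng_add[OF that[unfolded generated_subalgebra_def]] ring_hom_add[OF h, of x y]
    by (simp add: generated_subalgebra_def ring_of_type_algebra_simps)
  have diff: "x - y = x + scalar (- 1) * y" for x y :: "('x, 'k) free_algebra"
    by (simp add: scalar_def single_uminus)
  show ?thesis by unfold_locales (auto simp: diff intro: scalar mult add)
qed

theorem corollary3p1:
  fixes q \<rho> :: "'k::field" and \<delta> :: "nat \<Rightarrow> 'k"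
  assumes "(2::'k) \<noteq> 0"
    and "q \<noteq> 0"
    and "\<And>n::nat. n > 0 \<Longrightarrow> q ^ n \<noteq> 1"
    and "\<rho> \<noteq> 0"
  shows "generated_subalgebra (Atilde q \<rho> \<delta>) (\<lambda>c. Atilde_proj q \<rho> \<delta> (scalar c))
           {Atilde_proj q \<rho> \<delta> (fgen (W 0)), Atilde_proj q \<rho> \<delta> (fgen (W 1))}
         = carrier (Atilde q \<rho> \<delta>)"
proof -
  let ?R = "Atilde q \<rho> \<delta>" and ?p = "Atilde_proj q \<rho> \<delta>"
  let ?T = "{?p (fgen (W 0)), ?p (fgen (W 1))}"
  define B where "B = generated_subalgebra ?R (\<lambda>c. ?p (scalar c)) ?T"
  interpret R: ring ?R by (rule ring_Atilde)
  interpret S: subalgebra "?p -` B"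
    unfolding B_def by (rule subalgebra_vimage_generated_subalgebra[OF Atilde_proj_hom ring_Atilde])
  have q: "q + inverse q \<noteq> 0"
  proof
    assume "q + inverse q = 0"
    then have "q * q = - 1" using \<open>q \<noteq> 0\<close> by (simp add: field_simps eq_neg_iff_add_eq_0)
    then have "q ^ 4 = 1" by (simp add: eval_nat_numeral)
    then show False using assms(3)[of 4] by simp
  qed
  have zero: "\<zero>\<^bsub>?R\<^esub> \<in> B"
    unfolding B_def generated_subalgebra_def by (rule R.zero_in_generate)
  have "?p -` B = UNIV"
  proof (rule subalgebra_eq_UNIV[OF S.subalgebra_axioms \<open>2 \<noteq> 0\<close> q \<open>\<rho> \<noteq> 0\<close>])
    show "coefficients r \<subseteq> ?p -` B" if "r \<in> relations q \<rho>" for r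
      using Atilde_proj_coefficient[OF that] zero by auto
    show "\<Delta> q \<rho> k \<in> ?p -` B" for k
      \<comment> \<open>\<open>\<Delta> q \<rho> k\<close> differs from an element of the kernel by
        a scalar, so the values of \<open>\<delta>\<close> do not matter.\<close>
      using S.diffD1[OF _ S.scalar, of "\<Delta> q \<rho> k" "2 * \<delta> k"] zero by (simp add: Atilde_proj_\<Delta>)
    show "fgen (W 0) \<in> ?p -` B" "fgen (W 1) \<in> ?p -` B"
      unfolding B_def generated_subalgebra_def by (auto intro: generate_ring.incl)
  qed
  then have "carrier ?R \<subseteq> B"
    unfolding Atilde_proj_surj[symmetric] by blast
  moreover have "B \<subseteq> carrier ?R"
    unfolding B_def generated_subalgebra_def Atilde_proj_surj[symmetric]
    by (rule R.generate_ring_incl[unfolded Atilde_proj_surj[symmetric]]) blast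
  ultimately show ?thesis by (simp add: B_def)
qed

end
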